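(* Call a triple of integers $(q,b,m)$ with $1\le b\le q$ and $m\ge 2$ a solution if $$\sum_{\substack{1\le i\le m-1\\ i\equiv b \bmod q}} i^2 = m^2 .$$ Then: (1) For every solution $(q,b,m)$, the number of terms in the sum on the left-hand side is two or four. (2) There are infinitely many solutions for which the sum has exactly two terms, and infinitely many solutions for which the sum has exactly four terms. (3) Every solution $(q,b,m)$ is "good", that is, it satisfies $$\left\lfloor \frac{m-b}{q}\right\rfloor=\left\lfloor\frac{m-b-1}{q}\right\rfloor .$$ (4) Each solution $(q,b,m)$ belongs to an infinite set of evenly spaced integer points along a line in $\mathbb{R}^3$ consisting of solutions, namely for every integer $j\ge 1$ the triple $(jq,jb,jm)$ is also a solution.
   Context: The number of terms in the sum is the number of integers $i$ with $1\le i\le m-1$ and $i\equiv b \pmod q$. *)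

theory Defs
  imports "HOL-Analysis.Analysis" "HOL-Number_Theory.Cong"
begin

definition summation_indices :: "int \<Rightarrow> int \<Rightarrow> int \<Rightarrow> int set" where
  "summation_indices q b m = {i. 1 \<le> i \<and> i \<le> m - 1 \<and> [i = b] (mod q)}"

definition num_terms :: "int \<Rightarrow> int \<Rightarrow> int \<Rightarrow> nat" where
  "num_terms q b m = card (summation_indices q b m)"

definition is_solution :: "int \<Rightarrow> int \<Rightarrow> int \<Rightarrow> bool" where
  "is_solution q b m \<longleftrightarrow>
     1 \<le> b \<and> b \<le> q \<and> 2 \<le> m \<and> (\<Sum>i\<in>summation_indices q b m. i\<^sup>2) = m\<^sup>2"

definition good :: "int \<Rightarrow> int \<Rightarrow> int \<Rightarrow> bool" where
  "good q b m \<longleftrightarrow>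
     \<lfloor>real_of_int (m - b) / real_of_int q\<rfloor> = \<lfloor>real_of_int (m - b - 1) / real_of_int q\<rfloor>"

definition integer_point :: "int \<Rightarrow> int \<Rightarrow> int \<Rightarrow> real ^ 3" where
  "integer_point q b m = vector [real_of_int q, real_of_int b, real_of_int m]"

text \<open>An infinite set of evenly spaced points along a line: the points reached from a
  starting point \<open>p\<close> by all nonnegative integer multiples of a nonzero step \<open>v\<close>.\<close>

definition evenly_spaced_on_line :: "(real ^ 3) set \<Rightarrow> bool" where
  "evenly_spaced_on_line S \<longleftrightarrow>
     (\<exists>p v. v \<noteq> 0 \<and> S = range (\<lambda>k::nat. p + real k *\<^sub>R v))"

end

theory Submission
  imports Defs
begin

text \<open>A solution with \<open>n\<close> terms satisfies
  \<open>(\<Sum>k<n. (b + k q)\<^sup>2) = m\<^sup>2\<close> and \<open>m \<le> b + n q\<close>. For \<open>n \<ge> 5\<close> the sum exceeds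
  \<open>(b + n q)\<^sup>2\<close>; for \<open>n = 3\<close> the equation \<open>3 (b + q)\<^sup>2 + 2 q\<^sup>2 = m\<^sup>2\<close> is refuted by descent
  at \<open>3\<close>; and \<open>n \<le> 1\<close> is immediate. A solution fails to be good only if \<open>m = b + n q\<close>; for
  \<open>n = 2\<close> this factors as \<open>(b - 3 q) (b + q) = 0\<close>, and for \<open>n = 4\<close> it becomes
  \<open>(3 b + 2 q)\<^sup>2 = 10 q\<^sup>2\<close>, refuted by descent at \<open>5\<close>. Solutions are closed under scaling, so
  \<open>5\<^sup>2 + 12\<^sup>2 = 13\<^sup>2\<close> and \<open>1\<^sup>2 + 15\<^sup>2 + 29\<^sup>2 + 43\<^sup>2 = 54\<^sup>2\<close> give infinitely many of each kind.\<close>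

section \<open>The index set as an arithmetic progression\<close>

lemma summation_indices_eq_progression:
  fixes q b m :: int
  assumes "1 \<le> b" "b \<le> q" "1 \<le> m"
  obtains n where "summation_indices q b m = (\<lambda>k. b + int k * q) ` {..<n}"
    "m \<le> b + int n * q" "n = 0 \<or> b + (int n - 1) * q < m"
proof -
  define d where "d = (m - 1 - b) div q"
  have q: "q > 0" using assms by linarith
  have "d * q + (m - 1 - b) mod q = m - 1 - b" unfolding d_def by (rule div_mult_mod_eq)
  then have lo: "d * q \<le> m - 1 - b" and hi: "m - 1 - b < (d + 1) * q"
    using pos_mod_sign [OF q, of "m - 1 - b"] pos_mod_bound [OF q, of "m - 1 - b"]
    by (simp_all add: distrib_right)
  \<comment> \<open>From \<open>b \<le> q\<close> and \<open>1 \<le> m\<close>,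
    \<open>m - 1 - b\<close> is at least \<open>-q\<close>, so \<open>d\<close> is at least -1 and
    \<open>nat (d + 1)\<close> truncates nothing.\<close>
  have "(-1) * q < (d + 1) * q" using hi assms by linarith
  then have d: "-1 \<le> d" using q by (simp only: mult_less_cancel_right_pos)
  define n where "n = nat (d + 1)"
  have n: "int n = d + 1" using d by (simp add: n_def)
  have "summation_indices q b m = (\<lambda>k. b + int k * q) ` {..<n}"
  proof (rule set_eqI, rule iffI)
    fix i assume "i \<in> summation_indices q b m"
    then have i: "1 \<le> i" "i \<le> m - 1" "[i = b] (mod q)"
      by (auto simp: summation_indices_def)
    then obtain k where k: "i = b + k * q"
      by (metis cong_iff_lin cong_sym mult.commute)
    \<comment> \<open>Because \<open>b \<le> q\<close>, \<open>b\<close> is the least positive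
      member of its residue class: \<open>i - b\<close> exceeds \<open>-q\<close>, which rules out
      negative \<open>k\<close>.\<close>
    have "(-1) * q < k * q" using i k assms by linarith
    then have "0 \<le> k" using q by (simp only: mult_less_cancel_right_pos)
    moreover have "k * q < (d + 1) * q" using i k hi by linarith
    then have "k < d + 1" using q by (simp only: mult_less_cancel_right_pos)
    ultimately have "nat k < n" "i = b + int (nat k) * q" using k n by auto
    then show "i \<in> (\<lambda>k. b + int k * q) ` {..<n}" by blast
  next
    fix i assume "i \<in> (\<lambda>k. b + int k * q) ` {..<n}"
    then obtain k where k: "k < n" "i = b + int k * q" by auto
    have "int k * q \<le> d * q" using k n q by (intro mult_right_mono) auto
    moreover have "0 \<le> int k * q" using q by simp
    ultimately have "1 \<le> i" "i \<le> m - 1" using k lo assms by linarith+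
    then show "i \<in> summation_indices q b m"
      using k by (simp add: summation_indices_def cong_iff_dvd_diff)
  qed
  moreover have "m \<le> b + int n * q" using hi n by simp
  moreover have "b + (int n - 1) * q < m" using lo n by simp
  ultimately show thesis using that by blast
qed

lemma inj_progression:
  fixes q b :: int
  assumes "q \<noteq> 0"
  shows "inj_on (\<lambda>k::nat. b + int k * q) A"
  using assms by (auto simp: inj_on_def)

lemma solution_progression:
  assumes "is_solution q b m"
  shows "(\<Sum>k<num_terms q b m. (b + int k * q)\<^sup>2) = m\<^sup>2"
    and "m \<le> b + int (num_terms q b m) * q"
    and "num_terms q b m = 0 \<or> b + (int (num_terms q b m) - 1) * q < m"
proof -
  have a: "1 \<le> b" "b \<le> q" "1 \<le> m" "(\<Sum>i\<in>summation_indices q b m. i\<^sup>2) = m\<^sup>2"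
    using assms by (auto simp: is_solution_def)
  obtain n where n: "summation_indices q b m = (\<lambda>k. b + int k * q) ` {..<n}"
    "m \<le> b + int n * q" "n = 0 \<or> b + (int n - 1) * q < m"
    using summation_indices_eq_progression a by metis
  have inj: "inj_on (\<lambda>k::nat. b + int k * q) {..<n}"
    using a by (intro inj_progression) auto
  have "num_terms q b m = n"
    unfolding num_terms_def n(1) by (simp add: card_image inj)
  then show "(\<Sum>k<num_terms q b m. (b + int k * q)\<^sup>2) = m\<^sup>2"
    "m \<le> b + int (num_terms q b m) * q"
    "num_terms q b m = 0 \<or> b + (int (num_terms q b m) - 1) * q < m"
    using a(4) n by (simp_all add: sum.reindex inj)
qed

section \<open>Possible numbers of terms\<close>

lemma sum_squares_progression_gt:
  fixes q b :: int
  assumes "0 < b" "0 < q" "5 \<le> n"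
  shows "(b + int n * q)\<^sup>2 < (\<Sum>k<n. (b + int k * q)\<^sup>2)"
  using assms(3)
proof (induction n rule: dec_induct)
  case base
  \<comment> \<open>This polynomial is the five-term sum minus
    \<open>(b + 5 * q)\<^sup>2\<close>.\<close>
  have "0 < 4 * b\<^sup>2 + 10 * (b * q) + 5 * q\<^sup>2" using assms by (simp add: add_pos_pos)
  then show ?case
    by (simp add: eval_nat_numeral power2_eq_square algebra_simps)
next
  case (step n)
  have "5 * q \<le> int n * q" using step assms by (intro mult_right_mono) auto
  then have x: "5 * q \<le> b + int n * q" using assms by linarith
  \<comment> \<open>With \<open>x = b + int n * q\<close>, the new term adds
    \<open>x\<^sup>2\<close> to a sum already above \<open>x\<^sup>2\<close>, so
    \<open>(x + q)\<^sup>2 \<le> 2 * x\<^sup>2\<close> suffices. That is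
    \<open>2 * q\<^sup>2 \<le> (x - q)\<^sup>2\<close>, which follows once \<open>x - q\<close> is
    at least \<open>2 * q\<close>.\<close>
  have "(2 * q)\<^sup>2 \<le> (b + int n * q - q)\<^sup>2"
    using x assms by (intro power_mono) auto
  moreover have "(b + int n * q + q)\<^sup>2
      = 2 * (b + int n * q)\<^sup>2 - (b + int n * q - q)\<^sup>2 + 2 * q\<^sup>2"
    by (simp add: power2_eq_square algebra_simps)
  moreover have "(2 * q)\<^sup>2 = 4 * q\<^sup>2" by simp
  ultimately have "(b + int n * q + q)\<^sup>2 \<le> 2 * (b + int n * q)\<^sup>2"
    using zero_le_power2 [of q] by linarith
  then show ?case using step.IH by (simp add: algebra_simps)
qed

text \<open>Infinite descent: division by \<open>p\<close> stays within \<open>P\<close> and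
  strictly shrinks \<open>\<bar>y\<bar>\<close> as long as \<open>y\<close> is nonzero.\<close>

lemma int_pair_descent:
  fixes x y :: int
  assumes "\<And>x y. P x y \<Longrightarrow> \<exists>u v. x = p * u \<and> y = p * v \<and> P u v"
    and "1 < p" "P x y"
  shows "y = 0"
  using assms(3)
proof (induction "nat \<bar>y\<bar>" arbitrary: x y rule: less_induct)
  case less
  obtain u v where uv: "x = p * u" "y = p * v" "P u v" using assms(1) less.prems by blast
  show ?case
  proof (rule ccontr)
    assume "y \<noteq> 0"
    then have "v \<noteq> 0" using uv by auto
    then have "1 * \<bar>v\<bar> < p * \<bar>v\<bar>" using assms(2) by (intro mult_strict_right_mono) auto
    then have "nat \<bar>v\<bar> < nat \<bar>y\<bar>" using uv assms(2) by (simp add: abs_mult)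
    then show False using less.hyps uv \<open>v \<noteq> 0\<close> by blast
  qed
qed

lemma three_square_plus_two_square:
  fixes x y z :: int
  assumes "3 * x\<^sup>2 + 2 * y\<^sup>2 = z\<^sup>2"
  shows "y = 0"
\<comment> \<open>The descent acts on pairs, so the third variable \<open>x\<close> is hidden by an
  existential quantifier; it is shown divisible by 3 only after \<open>z\<close> and
  \<open>y\<close> are.\<close>
proof (rule int_pair_descent [where P = "\<lambda>z y. \<exists>x. 3 * x\<^sup>2 + 2 * y\<^sup>2 = z\<^sup>2" and p = 3])
  fix z y :: int
  assume "\<exists>x. 3 * x\<^sup>2 + 2 * y\<^sup>2 = z\<^sup>2"
  then obtain x where x: "3 * x\<^sup>2 + 2 * y\<^sup>2 = z\<^sup>2" ..
  have sq: "w\<^sup>2 mod 3 = (if w mod 3 = 0 then 0 else 1)" for w :: int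
  proof -
    have "w mod 3 = 0 \<or> w mod 3 = 1 \<or> w mod 3 = 2" by presburger
    moreover have "w\<^sup>2 mod 3 = (w mod 3)\<^sup>2 mod 3" by (simp add: power_mod)
    ultimately show ?thesis by auto
  qed
  \<comment> \<open>Squares are 0 or 1 modulo 3, so twice a square is 0 or 2, and the two sides
    agree only at 0.\<close>
  have "z\<^sup>2 mod 3 = 2 * y\<^sup>2 mod 3" using x by presburger
  then have "z mod 3 = 0 \<and> y mod 3 = 0" using sq [of y] sq [of z]
    by (simp split: if_splits) presburger+
  then obtain u v where uv: "z = 3 * u" "y = 3 * v" by (meson dvdE mod_0_imp_dvd)
  have "x\<^sup>2 = 3 * (u\<^sup>2 - 2 * v\<^sup>2)" using x uv by (simp add: power2_eq_square)
  then have "x\<^sup>2 mod 3 = 0" by simp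
  then have "x mod 3 = 0" using sq [of x] by (simp split: if_splits)
  then obtain w where w: "x = 3 * w" by (meson dvdE mod_0_imp_dvd)
  have "3 * w\<^sup>2 + 2 * v\<^sup>2 = u\<^sup>2" using x uv w by (simp add: power2_eq_square)
  then show "\<exists>u v. z = 3 * u \<and> y = 3 * v \<and> (\<exists>x. 3 * x\<^sup>2 + 2 * v\<^sup>2 = u\<^sup>2)"
    using uv by blast
qed (use assms in auto)

lemma square_eq_ten_square:
  fixes x y :: int
  assumes "x\<^sup>2 = 10 * y\<^sup>2"
  shows "y = 0"
proof (rule int_pair_descent [where P = "\<lambda>x y. x\<^sup>2 = 10 * y\<^sup>2" and p = 5])
  have five: "prime (5::int)" by simp
  fix x y :: int
  assume x: "x\<^sup>2 = 10 * y\<^sup>2"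
  then have "5 dvd x\<^sup>2" by simp
  then have "5 dvd x" using five prime_dvd_power by blast
  then obtain u where u: "x = 5 * u" by auto
  then have "5 * u\<^sup>2 = 2 * y\<^sup>2" using x by (simp add: power2_eq_square)
  then have "5 dvd y\<^sup>2" by presburger
  then have "5 dvd y" using five prime_dvd_power by blast
  then obtain v where v: "y = 5 * v" by auto
  show "\<exists>u v. x = 5 * u \<and> y = 5 * v \<and> u\<^sup>2 = 10 * v\<^sup>2"
    using x u v by (auto simp: power2_eq_square)
qed (use assms in auto)

lemma solution_num_terms:
  assumes "is_solution q b m"
  shows "num_terms q b m = 2 \<or> num_terms q b m = 4"
proof -
  define n where "n = num_terms q b m"
  note p = solution_progression [OF assms, folded n_def]
  have a: "1 \<le> b" "b \<le> q" "2 \<le> m" using assms by (auto simp: is_solution_def)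
  have "n \<noteq> 0"
  proof
    assume "n = 0"
    then have "m\<^sup>2 = 0" using p(1) by simp
    then show False using a by simp
  qed
  moreover have "n \<noteq> 1"
  proof
    assume "n = 1"
    then have "b\<^sup>2 = m\<^sup>2" "b < m" using p by auto
    then show False using a by (simp add: power2_eq_iff_nonneg)
  qed
  moreover have "n \<noteq> 3"
  proof
    assume "n = 3"
    \<comment> \<open>Centred at the middle term \<open>b + q\<close>, the outer terms are
      \<open>(b + q) - q\<close> and \<open>(b + q) + q\<close>, and the cross terms cancel.\<close>
    then have "3 * (b + q)\<^sup>2 + 2 * q\<^sup>2 = m\<^sup>2"
      using p(1) by (simp add: eval_nat_numeral power2_eq_square algebra_simps)
    then show False using three_square_plus_two_square a by fastforce
  qed
  moreover have "\<not> 5 \<le> n"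
  proof
    assume "5 \<le> n"
    then have "(b + int n * q)\<^sup>2 < m\<^sup>2"
      using sum_squares_progression_gt [of b q n] p(1) a by simp
    moreover have "m\<^sup>2 \<le> (b + int n * q)\<^sup>2" using p(2) a by (intro power_mono) auto
    ultimately show False by simp
  qed
  ultimately show ?thesis unfolding n_def by linarith
qed

section \<open>Goodness\<close>

lemma solution_good:
  assumes "is_solution q b m"
  shows "good q b m"
proof -
  define n where "n = num_terms q b m"
  note p = solution_progression [OF assms, folded n_def]
  have a: "1 \<le> b" "b \<le> q" "2 \<le> m" using assms by (auto simp: is_solution_def)
  have n: "n = 2 \<or> n = 4" using solution_num_terms [OF assms] n_def by simp
  \<comment> \<open>Since \<open>m - b\<close> lies above \<open>(n - 1) * q\<close> and is at most
    \<open>n * q\<close>, subtracting 1 changes the quotient only at this right endpoint.\<close>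
  have "m \<noteq> b + int n * q"
  proof
    assume m: "m = b + int n * q"
    from n show False
    proof
      assume "n = 2"
      then have "(b - 3 * q) * (b + q) = 0"
        using p(1) m by (simp add: eval_nat_numeral power2_eq_square algebra_simps)
      then show False using a by auto
    next
      assume "n = 4"
      \<comment> \<open>The equation reduces to
        \<open>3 * b\<^sup>2 + 4 * b * q - 2 * q\<^sup>2 = 0\<close>; multiplying by 3 completes the
        square.\<close>
      then have "(3 * b + 2 * q)\<^sup>2 = 10 * q\<^sup>2"
        using p(1) m by (simp add: eval_nat_numeral power2_eq_square algebra_simps)
      then show False using square_eq_ten_square a by fastforce
    qed
  qed
  then have hi: "m < b + int n * q" and lo: "b + (int n - 1) * q < m" using p n by auto
  have "(m - b) div q = int n - 1"
    by (rule int_div_pos_eq [where r = "m - b - (int n - 1) * q"])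
       (use hi lo in \<open>auto simp: algebra_simps\<close>)
  moreover have "(m - b - 1) div q = int n - 1"
    by (rule int_div_pos_eq [where r = "m - b - 1 - (int n - 1) * q"])
       (use hi lo in \<open>auto simp: algebra_simps\<close>)
  ultimately show ?thesis unfolding good_def floor_divide_of_int_eq by simp
qed

section \<open>Scaling of solutions\<close>

lemma summation_indices_scale:
  fixes j q b m :: int
  assumes "0 < j"
  shows "summation_indices (j * q) (j * b) (j * m) = (*) j ` summation_indices q b m"
proof (rule set_eqI, rule iffI)
  fix i assume "i \<in> summation_indices (j * q) (j * b) (j * m)"
  \<comment> \<open>The upper bound is used in the strict form \<open>i < j * m\<close>, which
    scales by \<open>j\<close>, whereas \<open>i \<le> j * m - 1\<close> does not.\<close>
  then have i: "1 \<le> i" "i < j * m" "j * q dvd i - j * b"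
    by (auto simp: summation_indices_def cong_iff_dvd_diff)
  then obtain k where k: "i = j * (b + q * k)"
    by (auto simp: dvd_def algebra_simps)
  have "0 < j * (b + q * k)" "j * (b + q * k) < j * m" using i k by auto
  then have "0 < b + q * k" "b + q * k < m"
    using assms by (simp_all only: zero_less_mult_pos mult_less_cancel_left_pos)
  then show "i \<in> (*) j ` summation_indices q b m"
    using k by (auto simp: summation_indices_def cong_iff_dvd_diff)
next
  fix i assume "i \<in> (*) j ` summation_indices q b m"
  then obtain k where k: "i = j * k" "1 \<le> k" "k < m" "q dvd k - b"
    by (auto simp: summation_indices_def cong_iff_dvd_diff)
  have "0 < i" "i < j * m" using k assms by auto
  moreover have "j * q dvd i - j * b"
    using k by (simp add: right_diff_distrib [symmetric])
  ultimately show "i \<in> summation_indices (j * q) (j * b) (j * m)"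
    by (auto simp: summation_indices_def cong_iff_dvd_diff)
qed

lemma
  assumes "0 < j"
  shows num_terms_scale: "num_terms (j * q) (j * b) (j * m) = num_terms q b m"
    and solution_scale: "is_solution q b m \<Longrightarrow> is_solution (j * q) (j * b) (j * m)"
proof -
  have inj: "inj_on ((*) j) A" for A using assms by (simp add: inj_on_def)
  show "num_terms (j * q) (j * b) (j * m) = num_terms q b m"
    by (simp add: num_terms_def summation_indices_scale assms card_image inj)
  assume s: "is_solution q b m"
  then have "0 < j * b" "j * b \<le> j * q" "m \<le> j * m" "2 \<le> m"
    using assms by (auto simp: is_solution_def)
  then have "1 \<le> j * b" "j * b \<le> j * q" "2 \<le> j * m" by linarith+
  with s show "is_solution (j * q) (j * b) (j * m)"
    by (auto simp: is_solution_def summation_indices_scale assms sum.reindex inj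
        power_mult_distrib sum_distrib_left [symmetric])
qed

lemma infinite_solutions_scale:
  assumes "is_solution q b m"
  shows "infinite {(q', b', m'). is_solution q' b' m' \<and> num_terms q' b' m' = num_terms q b m}"
    (is "infinite ?S")
proof -
  \<comment> \<open>\<open>Suc k\<close> keeps the factor positive; distinct factors give distinct
    triples because \<open>q\<close> is positive.\<close>
  let ?f = "\<lambda>k::nat. (int (Suc k) * q, int (Suc k) * b, int (Suc k) * m)"
  have "inj ?f" using assms by (auto simp: inj_on_def is_solution_def)
  then have "infinite (range ?f)" by (rule range_inj_infinite)
  moreover have "range ?f \<subseteq> ?S"
    using num_terms_scale solution_scale [OF _ assms] by (auto simp del: of_nat_Suc)
  ultimately show ?thesis using finite_subset by blast
qed

section \<open>Explicit solutions with two and four terms\<close>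

lemma indices_7_5_13: "summation_indices 7 5 13 = {5, 12}"
proof -
  have "i \<in> {5, 12}" if i: "1 \<le> i" "i \<le> 13 - 1" "i mod 7 = 5" for i :: int
  proof -
    define t where "t = i div 7"
    have "i = 7 * t + 5" using i(3) div_mult_mod_eq [of i 7] by (simp add: t_def)
    moreover from this i have "t = 0 \<or> t = 1" by linarith
    ultimately show ?thesis by auto
  qed
  then show ?thesis unfolding summation_indices_def cong_def by auto
qed

lemma indices_14_1_54: "summation_indices 14 1 54 = {1, 15, 29, 43}"
proof -
  have "i \<in> {1, 15, 29, 43}" if i: "1 \<le> i" "i \<le> 54 - 1" "i mod 14 = 1" for i :: int
  proof -
    define t where "t = i div 14"
    have "i = 14 * t + 1" using i(3) div_mult_mod_eq [of i 14] by (simp add: t_def)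
    moreover from this i have "t = 0 \<or> t = 1 \<or> t = 2 \<or> t = 3" by linarith
    ultimately show ?thesis by auto
  qed
  then show ?thesis unfolding summation_indices_def cong_def by auto
qed

section \<open>Multiples of a solution as points on a line\<close>

lemma integer_point_scale:
  "integer_point (j * q) (j * b) (j * m) = of_int j *\<^sub>R integer_point q b m"
  by (simp add: integer_point_def vec_eq_iff forall_3)

lemma positive_multiples_eq_range:
  fixes v :: "'a::real_vector"
  shows "{of_int j *\<^sub>R v | j :: int. 1 \<le> j} = range (\<lambda>k::nat. v + real k *\<^sub>R v)"
proof -
  have "{of_int j *\<^sub>R v | j :: int. 1 \<le> j} = (\<lambda>j. of_int j *\<^sub>R v) ` {j::int. 1 \<le> j}" by auto
  \<comment> \<open>The shift \<open>j = k + 1\<close> starts the ray at \<open>v\<close> itself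
    rather than at the origin, so \<open>v\<close> is both the starting point and the step.\<close>
  also have "{j::int. 1 \<le> j} = range (\<lambda>k. int k + 1)"
    by (auto simp: image_iff) presburger
  finally show ?thesis by (simp add: image_image algebra_simps)
qed

lemma solution_multiples:
  assumes "is_solution q b m"
  defines "P \<equiv> {integer_point (j * q) (j * b) (j * m) | j :: int. 1 \<le> j}"
  shows "integer_point q b m \<in> P" "infinite P" "evenly_spaced_on_line P"
proof -
  define v where "v = integer_point q b m"
  \<comment> \<open>The first coordinate \<open>q\<close> is positive, so the step is nonzero and
    the multiples are pairwise distinct.\<close>
  have "v $ 1 = of_int q" by (simp add: v_def integer_point_def)
  then have v: "v \<noteq> 0" using assms(1) by (auto simp: is_solution_def)
  have P: "P = range (\<lambda>k::nat. v + real k *\<^sub>R v)"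
    unfolding P_def integer_point_scale v_def by (rule positive_multiples_eq_range)
  show "integer_point q b m \<in> P"
    unfolding P by (rule range_eqI [of _ _ 0]) (simp add: v_def)
  show "infinite P"
    unfolding P using v by (intro range_inj_infinite) (simp add: inj_on_def)
  show "evenly_spaced_on_line P"
    unfolding evenly_spaced_on_line_def using P v by blast
qed

theorem theorem1p4:
  "(\<forall>q b m :: int. is_solution q b m \<longrightarrow> num_terms q b m = 2 \<or> num_terms q b m = 4) \<and>
   infinite {(q, b, m). is_solution q b m \<and> num_terms q b m = 2} \<and>
   infinite {(q, b, m). is_solution q b m \<and> num_terms q b m = 4} \<and>
   (\<forall>q b m :: int. is_solution q b m \<longrightarrow> good q b m) \<and>
   (\<forall>q b m :: int. is_solution q b m \<longrightarrow>
      (\<forall>j::int. 1 \<le> j \<longrightarrow> is_solution (j * q) (j * b) (j * m)) \<and>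
      (let P = {integer_point (j * q) (j * b) (j * m) | j :: int. 1 \<le> j}
       in integer_point q b m \<in> P \<and> infinite P \<and> evenly_spaced_on_line P))"
proof (intro conjI)
  have "is_solution 7 5 13" "num_terms 7 5 13 = 2"
    by (simp_all add: is_solution_def num_terms_def indices_7_5_13)
  then show "infinite {(q, b, m). is_solution q b m \<and> num_terms q b m = 2}"
    using infinite_solutions_scale [of 7 5 13] by simp
  have "is_solution 14 1 54" "num_terms 14 1 54 = 4"
    by (simp_all add: is_solution_def num_terms_def indices_14_1_54)
  then show "infinite {(q, b, m). is_solution q b m \<and> num_terms q b m = 4}"
    using infinite_solutions_scale [of 14 1 54] by simp
  show "\<forall>q b m :: int. is_solution q b m \<longrightarrow>
      (\<forall>j::int. 1 \<le> j \<longrightarrow> is_solution (j * q) (j * b) (j * m)) \<and>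
      (let P = {integer_point (j * q) (j * b) (j * m) | j :: int. 1 \<le> j}
       in integer_point q b m \<in> P \<and> infinite P \<and> evenly_spaced_on_line P)"
    unfolding Let_def by (intro allI impI conjI solution_scale solution_multiples) simp_all
qed (use solution_num_terms solution_good in blast)+

end
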